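(* None of the following voting procedures satisfies the social disappointment criterion (SDC): plurality, the Borda count, Condorcet's method, Copeland's method, sequential pairwise voting with a fixed agenda, and the Hare system. That is, for each of these procedures $V$ there exist a finite set $A$ with $|A|\ge 3$ (and, for sequential pairwise voting, an agenda on $A$), a positive integer $n$, an $(A,n)$-profile $P$ and an alternative $x\in A$ such that at least $n/2$ of the voters rank $x$ last in $P$ and $x\in V(P)$.
   Context: A ballot is a linear ordering of the finite set $A$ of alternatives, $|A|\ge 3$ (a strict ranking without ties). An $(A,n)$-profile $P$ is an $n$-tuple of ballots, one for each voter in $N=\{1,\dots,n\}$. A voting procedure assigns to each profile $P$ a set $V(P)\subseteq A$ of winners. $W(x,y,P)$ is the number of voters ranking $x$ above $y$. SDC: for every profile $P$ and every $x\in A$, if at least $n/2$ of the $n$ voters rank $x$ last, then $x\notin V(P)$. Procedures: - Plurality: winners are the alternatives ranked first by the most voters. - Borda: with $k=|A|$, each ballot gives $k-1$ points to its first alternative, $k-2$ to its second, ..., $0$ to its last; winners are the alternatives with the largest total. - Condorcet's method: $x$ is a winner iff $W(x,y,P)\ge W(y,x,P)$ for all $y\in A$. - Copeland: the score of $x$ is the number of $y$ with $W(x,y,P)>W(y,x,P)$ minus the number of $y$ with $W(y,x,P)>W(x,y,P)$; winners are the alternatives with the largest score. - Sequential pairwise voting with a fixed agenda (a fixed ordering $a_1,\dots,a_k$ of $A$): start with the surviving set $\{a_1\}$; at each step the next alternative of the agenda is compared one-on-one (by $W$) with the surviving alternatives; an alternative which loses strictly such a comparison is deleted, and in case of a tie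 both alternatives survive. The alternatives surviving at the end are the winners. - Hare: repeatedly delete the alternative or alternatives with the fewest first-place votes (restricting ballots to the remaining alternatives); the last group of alternatives to be deleted (i.e. the set reached when all remaining alternatives have equally many first-place votes) is the set of winners. *)

theory Defs
  imports Complex_Main "HOL-Library.FuncSet"
begin

(* A ballot is a linear order r on the set of alternatives; as usual for order relations,
   (y, x) \<in> r reads "y \<le> x", and greater means ranked higher. *)

definition ranks_above :: "'a rel \<Rightarrow> 'a \<Rightarrow> 'a \<Rightarrow> bool" where
  "ranks_above r x y \<longleftrightarrow> x \<noteq> y \<and> (y, x) \<in> r"

(* The next two notions depend only on r restricted to B. *)

definition ranks_first :: "'a set \<Rightarrow> 'a rel \<Rightarrow> 'a \<Rightarrow> bool" where
  "ranks_first B r x \<longleftrightarrow> x \<in> B \<and> (\<forall>y \<in> B - {x}. ranks_above r x y)"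

definition ranks_last :: "'a set \<Rightarrow> 'a rel \<Rightarrow> 'a \<Rightarrow> bool" where
  "ranks_last B r x \<longleftrightarrow> x \<in> B \<and> (\<forall>y \<in> B - {x}. ranks_above r y x)"

definition profiles :: "'a set \<Rightarrow> nat \<Rightarrow> (nat \<Rightarrow> 'a rel) set" where
  "profiles A n = {1..n} \<rightarrow>\<^sub>E {r. linear_order_on A r}"

definition SDC :: "'a set \<Rightarrow> nat \<Rightarrow> ((nat \<Rightarrow> 'a rel) \<Rightarrow> 'a set) \<Rightarrow> bool" where
  "SDC A n V \<longleftrightarrow> (\<forall>P \<in> profiles A n. \<forall>x \<in> A.
     real (card {i \<in> {1..n}. ranks_last A (P i) x}) \<ge> real n / 2 \<longrightarrow> x \<notin> V P)"

definition W :: "nat \<Rightarrow> 'a \<Rightarrow> 'a \<Rightarrow> (nat \<Rightarrow> 'a rel) \<Rightarrow> nat" where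
  "W n x y P = card {i \<in> {1..n}. ranks_above (P i) x y}"

definition first_votes :: "nat \<Rightarrow> (nat \<Rightarrow> 'a rel) \<Rightarrow> 'a set \<Rightarrow> 'a \<Rightarrow> nat" where
  "first_votes n P B x = card {i \<in> {1..n}. ranks_first B (P i) x}"

definition plurality :: "'a set \<Rightarrow> nat \<Rightarrow> (nat \<Rightarrow> 'a rel) \<Rightarrow> 'a set" where
  "plurality A n P = {x \<in> A. \<forall>y \<in> A. first_votes n P A y \<le> first_votes n P A x}"

(* For x in a finite A and r a linear order on A, at most card A - 1 alternatives are above x,
   so the subtraction does not truncate. *)
definition borda_points :: "'a set \<Rightarrow> 'a rel \<Rightarrow> 'a \<Rightarrow> nat" where
  "borda_points A r x = card A - 1 - card {y \<in> A. ranks_above r y x}"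

definition borda_score :: "'a set \<Rightarrow> nat \<Rightarrow> (nat \<Rightarrow> 'a rel) \<Rightarrow> 'a \<Rightarrow> nat" where
  "borda_score A n P x = (\<Sum>i \<in> {1..n}. borda_points A (P i) x)"

definition borda :: "'a set \<Rightarrow> nat \<Rightarrow> (nat \<Rightarrow> 'a rel) \<Rightarrow> 'a set" where
  "borda A n P = {x \<in> A. \<forall>y \<in> A. borda_score A n P y \<le> borda_score A n P x}"

definition condorcet :: "'a set \<Rightarrow> nat \<Rightarrow> (nat \<Rightarrow> 'a rel) \<Rightarrow> 'a set" where
  "condorcet A n P = {x \<in> A. \<forall>y \<in> A. W n x y P \<ge> W n y x P}"

definition copeland_score :: "'a set \<Rightarrow> nat \<Rightarrow> (nat \<Rightarrow> 'a rel) \<Rightarrow> 'a \<Rightarrow> int" where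
  "copeland_score A n P x =
     int (card {y \<in> A. W n x y P > W n y x P}) - int (card {y \<in> A. W n y x P > W n x y P})"

definition copeland :: "'a set \<Rightarrow> nat \<Rightarrow> (nat \<Rightarrow> 'a rel) \<Rightarrow> 'a set" where
  "copeland A n P = {x \<in> A. \<forall>y \<in> A. copeland_score A n P y \<le> copeland_score A n P x}"

(* An agenda on A is a list enumerating A without repetition. The next alternative b meets every
   member of the surviving set S, and the deletions take effect after all these comparisons. *)

definition agenda_on :: "'a set \<Rightarrow> 'a list \<Rightarrow> bool" where
  "agenda_on A as \<longleftrightarrow> distinct as \<and> set as = A"

definition pairwise_step :: "nat \<Rightarrow> (nat \<Rightarrow> 'a rel) \<Rightarrow> 'a \<Rightarrow> 'a set \<Rightarrow> 'a set" where
  "pairwise_step n P b S =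
     {s \<in> S. \<not> W n s b P < W n b s P} \<union> {c. c = b \<and> \<not> (\<exists>s \<in> S. W n b s P < W n s b P)}"

fun sequential_pairwise :: "'a list \<Rightarrow> nat \<Rightarrow> (nat \<Rightarrow> 'a rel) \<Rightarrow> 'a set" where
  "sequential_pairwise [] n P = {}"
| "sequential_pairwise (a # as) n P = fold (pairwise_step n P) as {a}"

definition fewest_first_votes :: "nat \<Rightarrow> (nat \<Rightarrow> 'a rel) \<Rightarrow> 'a set \<Rightarrow> 'a set" where
  "fewest_first_votes n P B = {x \<in> B. \<forall>y \<in> B. first_votes n P B x \<le> first_votes n P B y}"

(* The finiteness test only makes the recursion total; it always holds for finite sets A. *)
function hare :: "'a set \<Rightarrow> nat \<Rightarrow> (nat \<Rightarrow> 'a rel) \<Rightarrow> 'a set" where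
  "hare B n P =
     (if finite B \<and> \<not> (\<forall>x \<in> B. \<forall>y \<in> B. first_votes n P B x = first_votes n P B y)
      then hare (B - fewest_first_votes n P B) n P else B)"
  by auto
termination
proof (relation "measure (\<lambda>(B, n, P). card B)")
  fix B :: "'a set" and n :: nat and P :: "nat \<Rightarrow> 'a rel"
  assume *: "finite B \<and> \<not> (\<forall>x \<in> B. \<forall>y \<in> B. first_votes n P B x = first_votes n P B y)"
  then have "finite B" "B \<noteq> {}" by auto
  then obtain x where "x \<in> fewest_first_votes n P B"
    using arg_min_if_finite[of B "first_votes n P B"]
    unfolding fewest_first_votes_def by (auto simp: not_less)
  then have "B - fewest_first_votes n P B \<subset> B"
    unfolding fewest_first_votes_def by blast
  with \<open>finite B\<close> show "((B - fewest_first_votes n P B, n, P), (B, n, P))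
      \<in> measure (\<lambda>(B, n, P). card B)"
    by (auto intro: psubset_card_mono)
qed auto

declare hare.simps [simp del]

end

theory Submission imports Defs begin

text \<open>One profile defeats all six procedures: two voters with opposite ballots on three
  alternatives. All pairwise comparisons and all Borda scores are tied, and the first choice of
  one voter, which shares the most first-place votes, is the last choice of the other.\<close>

lemma condorcet_all_tied:
  assumes "\<And>x y. W n x y P = W n y x P"
  shows "condorcet A n P = A"
  using assms by (auto simp: condorcet_def)

text \<open>Both sets whose cardinalities are subtracted are empty, so every score is 0.\<close>

lemma copeland_all_tied:
  assumes "\<And>x y. W n x y P = W n y x P"
  shows "copeland A n P = A"
proof -
  have "\<not> W n x y P < W n y x P" for x y
    using assms[of x y] by simp
  then show ?thesis
    by (simp add: copeland_def copeland_score_def)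
qed

text \<open>No comparison has a strict loser, so each step merely adds the next agenda item, and
  folding \<open>insert\<close> collects the whole list.\<close>

lemma sequential_pairwise_all_tied:
  assumes "\<And>x y. W n x y P = W n y x P"
  shows "sequential_pairwise as n P = set as"
proof (cases as)
  case (Cons a bs)
  have "\<not> W n x y P < W n y x P" for x y
    using assms[of x y] by simp
  then have "pairwise_step n P b S = insert b S" for b S
    by (auto simp: pairwise_step_def)
  then have "pairwise_step n P = insert"
    by (intro ext)
  then show ?thesis
    by (simp add: Cons flip: union_set_fold)
qed simp

text \<open>Larger numbers stand higher, so 0 is last here and first in the converse. The bound 2
  keeps the relation inside \<open>{..2}\<close>.\<close>

definition ascending :: "nat rel" where
  "ascending = {(x, y). x \<le> y \<and> y \<le> 2}"

text \<open>The restricted abstraction is \<open>undefined\<close> off \<open>{1..2}\<close>, as the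
  extensional function space in \<open>profiles\<close> demands.\<close>

definition opposite_ballots :: "nat \<Rightarrow> nat rel" where
  "opposite_ballots = (\<lambda>i\<in>{1..2}. if i = 1 then ascending else ascending\<inverse>)"

lemma linear_order_ascending: "linear_order_on {..2} ascending"
  by (auto simp: ascending_def order_on_defs refl_on_def trans_def antisym_def total_on_def)

lemma opposite_ballots_in_profiles: "opposite_ballots \<in> profiles {..2} 2"
  using linear_order_ascending by (auto simp: profiles_def opposite_ballots_def)

text \<open>The voter counts in \<open>W\<close>, \<open>first_votes\<close> and \<open>SDC\<close>
  all become sums of two indicators.\<close>

lemma card_two_voters: "card {i \<in> {1..2::nat}. Q i} = of_bool (Q 1) + of_bool (Q 2)"
proof -
  have "{1..2::nat} = {1, 2}" by auto
  then have "{i \<in> {1..2}. Q i} = {i. i = 1 \<and> Q i} \<union> {i. i = 2 \<and> Q i}" by auto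
  then show ?thesis
    by (auto simp: Collect_conv_if)
qed

lemma above_opposite_ballots:
  "ranks_above (opposite_ballots 1) x y \<longleftrightarrow> y < x \<and> x \<le> 2"
  "ranks_above (opposite_ballots 2) x y \<longleftrightarrow> x < y \<and> y \<le> 2"
  by (auto simp: ranks_above_def opposite_ballots_def ascending_def)

text \<open>Exchanging \<open>x\<close> and \<open>y\<close> exchanges the two indicators. This
  includes numbers above 2, as the lemmas on tied comparisons assume ties throughout the
  type.\<close>

lemma W_opposite_ballots_commute: "W 2 x y opposite_ballots = W 2 y x opposite_ballots"
  unfolding W_def card_two_voters above_opposite_ballots by simp

lemma atMost_two: "{..2::nat} = {0, 1, 2}"
  by auto

text \<open>These are the two stages of the Hare elimination; in both, voter 1 puts 2 first and
  voter 2 puts 0 first.\<close>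

lemma first_votes_opposite_ballots:
  "first_votes 2 opposite_ballots {..2} x = of_bool (x = 0 \<or> x = 2)"
  "first_votes 2 opposite_ballots {0, 2} x = of_bool (x = 0 \<or> x = 2)"
  unfolding first_votes_def card_two_voters
  by (auto simp: ranks_first_def above_opposite_ballots atMost_two simp del: One_nat_def)

lemma plurality_opposite_ballots: "0 \<in> plurality {..2} 2 opposite_ballots"
  by (simp add: plurality_def first_votes_opposite_ballots)

lemma borda_opposite_ballots: "borda {..2} 2 opposite_ballots = {..2}"
proof -
  \<comment> \<open>The alternatives below \<open>x\<close> number \<open>x\<close> in one ballot
    and \<open>2 - x\<close> in the other, so the total is constant.\<close>
  have "borda_score {..2} 2 opposite_ballots x = 2" if "x \<le> 2" for x
  proof -
    have "{y \<in> {..2}. x < y \<and> y \<le> 2} = {x<..2}"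
      and "{y \<in> {..2}. y < x \<and> x \<le> 2} = {..<x}"
      using that by auto
    then have "borda_points {..2} (opposite_ballots 1) x = x"
      and "borda_points {..2} (opposite_ballots 2) x = 2 - x"
      using that unfolding borda_points_def above_opposite_ballots by simp_all
    moreover have "{1..2::nat} = {1, 2}" by auto
    ultimately show ?thesis
      using that by (simp add: borda_score_def)
  qed
  then show ?thesis
    by (auto simp: borda_def)
qed

lemma hare_opposite_ballots: "hare {..2} 2 opposite_ballots = {0, 2}"
proof -
  \<comment> \<open>Ranked in the middle by both voters, 1 has no first-place vote.\<close>
  have "fewest_first_votes 2 opposite_ballots {..2} = {1}"
    unfolding fewest_first_votes_def first_votes_opposite_ballots by (auto simp: atMost_two)
  moreover have "\<not> (\<forall>x\<in>{..2}. \<forall>y\<in>{..2}. first_votes 2 opposite_ballots {..2} x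
      = first_votes 2 opposite_ballots {..2} y)"
    unfolding first_votes_opposite_ballots by (auto simp: atMost_two)
  ultimately have "hare {..2} 2 opposite_ballots = hare ({..2} - {1}) 2 opposite_ballots"
    by (subst hare.simps) simp
  also have "{..2} - {1} = {0, 2::nat}"
    by auto
  \<comment> \<open>One vote each: the tie ends the recursion.\<close>
  also have "hare {0, 2} 2 opposite_ballots = {0, 2}"
    by (subst hare.simps) (simp add: first_votes_opposite_ballots)
  finally show ?thesis .
qed

text \<open>Voter 1 ranks 0 last, and one voter out of two meets the bound n/2 with
  equality.\<close>

lemma not_SDC_if_elects_0:
  assumes "0 \<in> V opposite_ballots"
  shows "\<not> SDC {..2} 2 V"
proof -
  have "ranks_last {..2} (opposite_ballots 1) 0"
    by (auto simp: ranks_last_def above_opposite_ballots simp del: One_nat_def)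
  then have "real (card {i \<in> {1..2}. ranks_last {..2} (opposite_ballots i) 0}) \<ge> real 2 / 2"
    unfolding card_two_voters by simp
  then show ?thesis
    using assms opposite_ballots_in_profiles unfolding SDC_def by blast
qed

theorem proposition2:
  shows "(\<exists>(A :: nat set) n. finite A \<and> card A \<ge> 3 \<and> n \<ge> 1 \<and> \<not> SDC A n (plurality A n))
     \<and> (\<exists>(A :: nat set) n. finite A \<and> card A \<ge> 3 \<and> n \<ge> 1 \<and> \<not> SDC A n (borda A n))
     \<and> (\<exists>(A :: nat set) n. finite A \<and> card A \<ge> 3 \<and> n \<ge> 1 \<and> \<not> SDC A n (condorcet A n))
     \<and> (\<exists>(A :: nat set) n. finite A \<and> card A \<ge> 3 \<and> n \<ge> 1 \<and> \<not> SDC A n (copeland A n))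
     \<and> (\<exists>(A :: nat set) agenda n. finite A \<and> card A \<ge> 3 \<and> agenda_on A agenda \<and> n \<ge> 1
          \<and> \<not> SDC A n (sequential_pairwise agenda n))
     \<and> (\<exists>(A :: nat set) n. finite A \<and> card A \<ge> 3 \<and> n \<ge> 1 \<and> \<not> SDC A n (hare A n))"
proof -
  note tied = W_opposite_ballots_commute
  have "\<not> SDC {..2} 2 (plurality {..2::nat} 2)"
    by (intro not_SDC_if_elects_0 plurality_opposite_ballots)
  moreover have "\<not> SDC {..2} 2 (borda {..2::nat} 2)"
    by (rule not_SDC_if_elects_0) (simp add: borda_opposite_ballots)
  moreover have "\<not> SDC {..2} 2 (condorcet {..2::nat} 2)"
    by (rule not_SDC_if_elects_0) (simp add: condorcet_all_tied[OF tied])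
  moreover have "\<not> SDC {..2} 2 (copeland {..2::nat} 2)"
    by (rule not_SDC_if_elects_0) (simp add: copeland_all_tied[OF tied])
  \<comment> \<open>Any order of the agenda would do, since ties let every alternative
    survive.\<close>
  moreover have "\<not> SDC {..2} 2 (sequential_pairwise [0, 1, 2::nat] 2)"
    by (rule not_SDC_if_elects_0) (simp add: sequential_pairwise_all_tied[OF tied])
  moreover have "\<not> SDC {..2} 2 (hare {..2::nat} 2)"
    by (rule not_SDC_if_elects_0) (simp add: hare_opposite_ballots)
  moreover have "agenda_on {..2} [0, 1, 2::nat]"
    by (auto simp: agenda_on_def)
  moreover have "finite {..2::nat}" "card {..2::nat} \<ge> 3" "(2::nat) \<ge> 1"
    by simp_all
  ultimately show ?thesis
    by blast
qed

end
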